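(* Let $D\ge 3$. For the folded cube $\square_{2D+1}$, the Terwilliger algebra $T$ with respect to $\mathbf 0$ coincides with the linear span $\mathcal A'$ of the matrices $M^t_{i,j}$, $(i,j,t)\in\mathcal I'$; moreover these matrices form a basis of $\mathcal A'$.
   Context: Let $S=\{1,\dots,2D+1\}$, $X$ the set of unordered pairs $\{u,u'\}$ of subsets of $S$ with $u\cap u'=\emptyset$, $u\cup u'=S$. The folded cube $\square_{2D+1}$ is the graph on $X$ with distance $\partial(x,y)=\min\{|x_1\triangle y_1|,|x_1\triangle y_2|\}$ for $x=\{x_1,x_2\},y=\{y_1,y_2\}$ (adjacent iff distance $1$); its diameter is $D$. Let $\mathbf 0=\{\emptyset,S\}$. Write each vertex as $x=(x_1,x_2)$ with $|x_1|<|x_2|$. Let $\mathcal I'=\{(i,j,t):0\le t\le i,j\le D,\ i+j-t\le 2D\}$. For $(i,j,t)\in\mathcal I'$, $M^t_{i,j}$ is the $X\times X$ matrix with $(x,y)$-entry $1$ if $|x_1|=i$, $|y_1|=j$, $|x_1\cap y_1|=t$, and $0$ otherwise. For $0\le k\le D$, $A_k$ is the distance-$k$ matrix and $E^*_k$ the diagonal matrix with $(y,y)$-entry $1$ iff $\partial(\mathbf 0,y)=k$. The Terwilliger algebra $T$ with respect to $\mathbf 0$ is the subalgebra of $\mathrm{Mat}_X(\mathbb C)$ generated by $A_0,\dots,A_D,E^*_0,\dots,E^*_D$. *)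

theory Defs
  imports Complex_Main "HOL-Library.Function_Algebras"
begin

type_synonym vertex = "nat set set"

definition ground :: "nat \<Rightarrow> nat set" where
  "ground D = {1..2 * D + 1}"

definition vertices :: "nat \<Rightarrow> vertex set" where
  "vertices D = {{u, u'} | u u'. u \<subseteq> ground D \<and> u' \<subseteq> ground D \<and> u \<inter> u' = {} \<and> u \<union> u' = ground D}"

text \<open>For a vertex \<open>x\<close>, the two parts have different sizes since the ground set has odd
  size, so \<open>small x\<close> and \<open>large x\<close> are the parts \<open>x\<^sub>1\<close>, \<open>x\<^sub>2\<close> in the ordering
  with \<open>|x\<^sub>1| < |x\<^sub>2|\<close>.\<close>

definition small :: "vertex \<Rightarrow> nat set" where
  "small x = (THE u. \<exists>u'. x = {u, u'} \<and> card u < card u')"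

definition large :: "vertex \<Rightarrow> nat set" where
  "large x = (THE u'. \<exists>u. x = {u, u'} \<and> card u < card u')"

text \<open>On vertices the value does not depend on how the parts are labelled, see
  \<open>fc_dist_eq\<close> below.\<close>

definition fc_dist :: "vertex \<Rightarrow> vertex \<Rightarrow> nat" where
  "fc_dist x y = min (card (sym_diff (small x) (small y))) (card (sym_diff (small x) (large y)))"

definition base_vertex :: "nat \<Rightarrow> vertex" where
  "base_vertex D = {{}, ground D}"

lemma small_large_eq:
  assumes "card u < card u'"
  shows "small {u, u'} = u" "large {u, u'} = u'" "small {u', u} = u" "large {u', u} = u'"
proof -
  have *: "{u, u'} = {v, v'} \<and> card v < card v' \<longleftrightarrow> v = u \<and> v' = u'" for v v'
    using assms by (auto simp: doubleton_eq_iff)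
  show "small {u, u'} = u" "large {u, u'} = u'"
    by (simp_all add: small_def large_def *)
  then show "small {u', u} = u" "large {u', u} = u'"
    by (simp_all add: insert_commute)
qed

lemma vertices_pair:
  assumes "{u, u'} \<in> vertices D"
  shows "u \<subseteq> ground D" "u' = ground D - u" "card u < card u' \<or> card u' < card u"
proof -
  have "u \<subseteq> ground D \<and> u' \<subseteq> ground D \<and> u \<inter> u' = {} \<and> u \<union> u' = ground D"
    using assms by (auto simp: vertices_def doubleton_eq_iff)
  then show 1: "u \<subseteq> ground D" and 2: "u' = ground D - u" by auto
  have fin: "finite (ground D)" "finite u"
    using 1 by (auto simp: ground_def intro: finite_subset)
  have "card u \<le> card (ground D)" using 1 fin by (intro card_mono) auto
  moreover have "card u' = card (ground D) - card u"
    using 1 2 fin by (simp add: card_Diff_subset)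
  moreover have "card (ground D) = 2 * D + 1" by (simp add: ground_def)
  ultimately show "card u < card u' \<or> card u' < card u" by presburger
qed

lemma fc_dist_eq:
  assumes "{x1, x2} \<in> vertices D" and "{y1, y2} \<in> vertices D"
  shows "fc_dist {x1, x2} {y1, y2} = min (card (sym_diff x1 y1)) (card (sym_diff x1 y2))"
proof -
  note x = vertices_pair[OF assms(1)] and y = vertices_pair[OF assms(2)]
  have "sym_diff x2 y1 = sym_diff x1 y2" and "sym_diff x2 y2 = sym_diff x1 y1"
    using x(1,2) y(1,2) by auto
  with x(3) y(3) show ?thesis
    by (elim disjE) (simp_all only: fc_dist_def small_large_eq min.commute)
qed

text \<open>A matrix with rows and columns indexed by the vertices is represented by a function that
  is zero outside the index set. Addition and zero are pointwise (from \<open>Function_Algebras\<close>); the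
  pointwise product of that theory is not used.\<close>

type_synonym matrix = "vertex \<Rightarrow> vertex \<Rightarrow> complex"

definition matrices :: "nat \<Rightarrow> matrix set" where
  "matrices D = {P. \<forall>x y. P x y \<noteq> 0 \<longrightarrow> x \<in> vertices D \<and> y \<in> vertices D}"

definition mat_scale :: "complex \<Rightarrow> matrix \<Rightarrow> matrix" where
  "mat_scale c P = (\<lambda>x y. c * P x y)"

definition mat_mult :: "nat \<Rightarrow> matrix \<Rightarrow> matrix \<Rightarrow> matrix" where
  "mat_mult D P Q = (\<lambda>x y. \<Sum>z\<in>vertices D. P x z * Q z y)"

definition mat_one :: "nat \<Rightarrow> matrix" where
  "mat_one D = (\<lambda>x y. if x \<in> vertices D \<and> y = x then 1 else 0)"

global_interpretation mat_vs: vector_space mat_scale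
  by unfold_locales (simp_all add: mat_scale_def fun_eq_iff algebra_simps)

definition subalgebra :: "nat \<Rightarrow> matrix set \<Rightarrow> bool" where
  "subalgebra D B \<longleftrightarrow> B \<subseteq> matrices D \<and> mat_vs.subspace B \<and> mat_one D \<in> B \<and>
    (\<forall>P\<in>B. \<forall>Q\<in>B. mat_mult D P Q \<in> B)"

lemma subalgebra_matrices: "subalgebra D (matrices D)"
proof -
  have "mat_mult D P Q \<in> matrices D" if "P \<in> matrices D" "Q \<in> matrices D" for P Q
    using that by (auto simp: matrices_def mat_mult_def elim!: sum.not_neutral_contains_not_neutral)
  moreover have "mat_vs.subspace (matrices D)"
    unfolding mat_vs.subspace_def
    by (simp add: matrices_def mat_scale_def) (metis add.right_neutral)
  moreover have "mat_one D \<in> matrices D"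
    by (auto simp: matrices_def mat_one_def)
  ultimately show ?thesis by (simp add: subalgebra_def)
qed

definition dist_mat :: "nat \<Rightarrow> nat \<Rightarrow> matrix" where
  "dist_mat D k = (\<lambda>x y. if x \<in> vertices D \<and> y \<in> vertices D \<and> fc_dist x y = k then 1 else 0)"

definition dual_idem :: "nat \<Rightarrow> nat \<Rightarrow> matrix" where
  "dual_idem D k =
    (\<lambda>x y. if x \<in> vertices D \<and> y = x \<and> fc_dist (base_vertex D) y = k then 1 else 0)"

definition terwilliger_algebra :: "nat \<Rightarrow> matrix set" where
  "terwilliger_algebra D = subalgebra D hull (dist_mat D ` {0..D} \<union> dual_idem D ` {0..D})"

definition index_set :: "nat \<Rightarrow> (nat \<times> nat \<times> nat) set" where
  "index_set D = {(i, j, t). t \<le> i \<and> t \<le> j \<and> i \<le> D \<and> j \<le> D \<and> i + j - t \<le> 2 * D}"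

definition M_mat :: "nat \<Rightarrow> nat \<times> nat \<times> nat \<Rightarrow> matrix" where
  "M_mat D = (\<lambda>(i, j, t) x y. if x \<in> vertices D \<and> y \<in> vertices D \<and>
     card (small x) = i \<and> card (small y) = j \<and> card (small x \<inter> small y) = t then 1 else 0)"

definition A_prime :: "nat \<Rightarrow> matrix set" where
  "A_prime D = mat_vs.span (M_mat D ` index_set D)"

text \<open>The family \<open>f\<close> indexed by \<open>I\<close> is a basis of \<open>V\<close>; in particular its members are
  pairwise distinct.\<close>

definition basis_family :: "('i \<Rightarrow> matrix) \<Rightarrow> 'i set \<Rightarrow> matrix set \<Rightarrow> bool" where
  "basis_family f I V \<longleftrightarrow> inj_on f I \<and> mat_vs.independent (f ` I) \<and> mat_vs.span (f ` I) = V"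

end

theory Submission
  imports Defs "HOL-Combinatorics.Permutations"
begin

text \<open>The inclusions \<open>\<A>' \<subseteq> T \<subseteq> \<I> \<subseteq> \<A>'\<close> hold, where \<open>\<I>\<close> is the algebra of matrices that are invariant
  under the symmetric group of the ground set. For the first one, \<open>M\<^sup>t\<^sub>i\<^sub>j = E\<^sup>*\<^sub>i A\<^sub>k E\<^sup>*\<^sub>j\<close>, where
  \<open>k\<close> is the smaller of \<open>i + j - 2t\<close> and \<open>2D + 1 - (i + j - 2t)\<close>: these two numbers have different
  parity, so \<open>i\<close>, \<open>j\<close> and \<open>k\<close> determine \<open>t\<close>. For the second one, the symmetric group fixes
  \<open>\<zero>\<close> and preserves distances. For the third one, two pairs \<open>(x, y)\<close> of vertices with the same
  \<open>|x\<^sub>1|\<close>, \<open>|y\<^sub>1|\<close> and \<open>|x\<^sub>1 \<inter> y\<^sub>1|\<close> lie in the same orbit.\<close>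

section \<open>Linear algebra and finite sets\<close>

lemma (in vector_space) independent_family_if_dual_functionals:
  assumes lin: "\<And>i. i \<in> I \<Longrightarrow> Vector_Spaces.linear scale (*) (\<phi> i)"
    and dual: "\<And>i j. i \<in> I \<Longrightarrow> j \<in> I \<Longrightarrow> \<phi> i (F j) = (if i = j then 1 else 0)"
  shows "inj_on F I" and "independent (F ` I)"
proof -
  show inj: "inj_on F I"
    using dual by (metis inj_onI zero_neq_one)
  have "F i \<notin> span (F ` I - {F i})" if i: "i \<in> I" for i
  proof
    interpret \<phi>: Vector_Spaces.linear scale "(*)" "\<phi> i"
      using lin[OF i] .
    assume "F i \<in> span (F ` I - {F i})"
    then have "\<phi> i (F i) = 0"
      by (rule \<phi>.eq_0_on_span[rotated]) (auto simp: dual i)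
    then show False
      by (simp add: dual i)
  qed
  then show "independent (F ` I)"
    by (auto simp: dependent_def)
qed

lemma card_sym_diff_plus_card_Int:
  assumes "finite A" "finite B"
  shows "card (sym_diff A B) + 2 * card (A \<inter> B) = card A + card B"
proof -
  have "card (sym_diff A B) = card (A - B) + card (B - A)"
    using assms by (intro card_Un_disjoint) auto
  then show ?thesis
    using card_Int_Diff[OF assms(1), of B] card_Int_Diff[OF assms(2), of A]
    by (simp add: Int_commute)
qed

lemma card_sym_diff_image:
  assumes "inj f"
  shows "card (sym_diff (f ` A) (f ` B)) = card (sym_diff A B)"
proof -
  have "sym_diff (f ` A) (f ` B) = f ` sym_diff A B"
    using assms by (simp add: image_Un image_set_diff)
  then show ?thesis
    using assms by (simp add: card_image inj_on_subset)
qed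

lemma ex_permutes_if_card_fibres_eq:
  assumes "finite S" and "\<And>b. card {x \<in> S. f x = b} = card {x \<in> S. g x = b}"
  obtains p where "p permutes S" "\<And>x. x \<in> S \<Longrightarrow> f x = g (p x)"
proof -
  have "image_mset f (mset_set S) = image_mset g (mset_set S)"
    using assms by (intro multiset_eqI) (simp add: count_image_mset_eq_card_vimage)
  with \<open>finite S\<close> show thesis
    using that by (rule image_mset_eq_implies_permutes) blast+
qed

lemma permutes_image_eqI:
  assumes "p permutes S" "A \<subseteq> S" "A' \<subseteq> S" and "\<And>x. x \<in> S \<Longrightarrow> x \<in> A \<longleftrightarrow> p x \<in> A'"
  shows "p ` A = A'"
proof -
  have "p ` A = p ` {x \<in> S. p x \<in> A'}"
    using assms(2,4) by (intro arg_cong[where f = "(`) p"]) auto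
  also have "\<dots> = p ` S \<inter> A'"
    by auto
  also have "\<dots> = A'"
    using assms(3) permutes_image[OF assms(1)] by auto
  finally show ?thesis .
qed

lemma ex_permutes_image_two_subsets:
  assumes "finite S" and sub: "A \<subseteq> S" "B \<subseteq> S" "A' \<subseteq> S" "B' \<subseteq> S"
    and card: "card A = card A'" "card B = card B'" "card (A \<inter> B) = card (A' \<inter> B')"
  obtains p where "p permutes S" "p ` A = A'" "p ` B = B'"
proof -
  have fin: "finite A" "finite B" "finite A'" "finite B'"
    using sub \<open>finite S\<close> by (auto intro: finite_subset)
  have diff: "card (A - B) = card (A' - B')" "card (B - A) = card (B' - A')"
    using card fin by (simp_all add: card_Diff_subset_Int Int_commute)
  have "card (A \<union> B) = card (A' \<union> B')"
    using card_Un_Int[OF fin(1,2)] card_Un_Int[OF fin(3,4)] card by simp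
  then have outside: "card (S - (A \<union> B)) = card (S - (A' \<union> B'))"
    using sub fin by (simp add: card_Diff_subset)
  have fibres: "{x \<in> S. x \<in> U \<and> x \<in> V} = U \<inter> V" "{x \<in> S. x \<in> U \<and> x \<notin> V} = U - V"
    "{x \<in> S. x \<notin> U \<and> x \<in> V} = V - U" "{x \<in> S. x \<notin> U \<and> x \<notin> V} = S - (U \<union> V)"
    if "U \<subseteq> S" "V \<subseteq> S" for U V
    using that by auto
  have "card {x \<in> S. (x \<in> A, x \<in> B) = c} = card {x \<in> S. (x \<in> A', x \<in> B') = c}" for c
  proof (cases c)
    case (Pair a b)
    then show ?thesis
      using card(3) diff outside by (cases a; cases b) (simp_all add: fibres sub)
  qed
  from ex_permutes_if_card_fibres_eq[OF \<open>finite S\<close> this]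
  obtain p where p: "p permutes S" "\<And>x. x \<in> S \<Longrightarrow> (x \<in> A, x \<in> B) = (p x \<in> A', p x \<in> B')"
    by blast
  have "p ` A = A'" "p ` B = B'"
    using p(2) by (intro permutes_image_eqI[OF p(1)] sub; simp)+
  with p(1) show thesis
    by (rule that)
qed

section \<open>Vertices and distances\<close>

lemma finite_ground [simp]: "finite (ground D)"
  by (simp add: ground_def)

lemma card_ground [simp]: "card (ground D) = 2 * D + 1"
  by (simp add: ground_def)

lemma vertices_subset_Pow_Pow: "vertices D \<subseteq> Pow (Pow (ground D))"
  by (auto simp: vertices_def)

lemma finite_vertices [simp]: "finite (vertices D)"
  using vertices_subset_Pow_Pow by (rule finite_subset) simp

lemma vertex_of_small_subset:
  assumes "a \<subseteq> ground D" "card a \<le> D"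
  shows "{a, ground D - a} \<in> vertices D" "small {a, ground D - a} = a"
    "large {a, ground D - a} = ground D - a"
proof -
  show "{a, ground D - a} \<in> vertices D"
    using assms(1) by (auto simp: vertices_def)
  have "card a < card (ground D - a)"
    using assms by (simp add: card_Diff_subset finite_subset)
  then show "small {a, ground D - a} = a" "large {a, ground D - a} = ground D - a"
    by (simp_all add: small_large_eq)
qed

lemma vertex_cases:
  assumes "x \<in> vertices D"
  obtains a where "a \<subseteq> ground D" "card a \<le> D" "x = {a, ground D - a}"
proof -
  obtain v v' where v: "x = {v, v'}"
    using assms by (auto simp: vertices_def)
  then have "card v < card v' \<or> card v' < card v"
    using assms vertices_pair(3) by blast
  with v obtain u u' where x: "x = {u, u'}" and lt: "card u < card u'"
    using insert_commute by metis
  note u = vertices_pair(1,2)[OF assms[unfolded x]]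
  have "card u' = 2 * D + 1 - card u"
    using u by (simp add: card_Diff_subset finite_subset)
  with lt have "card u \<le> D"
    by simp
  with u x show thesis
    using that by blast
qed

lemma
  assumes "x \<in> vertices D"
  shows small_subset_ground: "small x \<subseteq> ground D"
    and card_small_le: "card (small x) \<le> D"
    and large_eq_Diff_small: "large x = ground D - small x"
    and vertex_eq_small_large: "x = {small x, large x}"
  using assms by (auto elim!: vertex_cases simp: vertex_of_small_subset)

lemma finite_small: "x \<in> vertices D \<Longrightarrow> finite (small x)"
  using small_subset_ground finite_ground by (rule finite_subset)

lemma small_inject:
  assumes "x \<in> vertices D" "y \<in> vertices D"
  shows "small x = small y \<longleftrightarrow> x = y"
  using assms vertex_eq_small_large large_eq_Diff_small by metis

definition folded_weight :: "nat \<Rightarrow> nat \<Rightarrow> nat" where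
  "folded_weight D d = min d (2 * D + 1 - d)"

lemma folded_weight_le: "folded_weight D d \<le> D"
  by (simp add: folded_weight_def)

lemma folded_weight_inject_if_same_parity:
  assumes "d \<le> 2 * D + 1" "e \<le> 2 * D + 1" "even d \<longleftrightarrow> even e"
  shows "folded_weight D d = folded_weight D e \<longleftrightarrow> d = e"
proof
  assume "folded_weight D d = folded_weight D e"
  moreover have "d + e \<noteq> 2 * D + 1"
    using assms(3) by presburger
  ultimately show "d = e"
    using assms(1,2) by (auto simp: folded_weight_def min_def split: if_splits)
qed simp

lemma fc_dist_eq_folded_weight:
  assumes "x \<in> vertices D" "y \<in> vertices D"
  shows "fc_dist x y = folded_weight D (card (sym_diff (small x) (small y)))"
proof -
  note sub = small_subset_ground[OF assms(1)] small_subset_ground[OF assms(2)]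
  then have "sym_diff (small x) (large y) = ground D - sym_diff (small x) (small y)"
    by (auto simp: large_eq_Diff_small[OF assms(2)])
  moreover have "card (ground D - sym_diff (small x) (small y)) =
      2 * D + 1 - card (sym_diff (small x) (small y))"
    using sub by (subst card_Diff_subset) (auto intro: finite_subset)
  ultimately show ?thesis
    by (simp add: fc_dist_def folded_weight_def)
qed

lemma fc_dist_eq_iff_card_Int_eq:
  assumes x: "x \<in> vertices D" and y: "y \<in> vertices D"
    and t: "t \<le> card (small x)" "t \<le> card (small y)"
  shows "fc_dist x y = folded_weight D (card (small x) + card (small y) - 2 * t) \<longleftrightarrow>
    card (small x \<inter> small y) = t"
proof -
  let ?d = "card (sym_diff (small x) (small y))"
    and ?e = "card (small x) + card (small y) - 2 * t"
  have card_d: "?d + 2 * card (small x \<inter> small y) = card (small x) + card (small y)"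
    using finite_small[OF x] finite_small[OF y] by (rule card_sym_diff_plus_card_Int)
  have card_e: "?e + 2 * t = card (small x) + card (small y)"
    using t by simp
  have "?d + 2 * card (small x \<inter> small y) = ?e + 2 * t"
    unfolding card_d card_e ..
  then have "even ?d \<longleftrightarrow> even ?e"
    by presburger
  moreover have "?d \<le> 2 * D + 1" "?e \<le> 2 * D + 1"
    using card_d card_e card_small_le[OF x] card_small_le[OF y] by linarith+
  ultimately have "fc_dist x y = folded_weight D ?e \<longleftrightarrow> ?d = ?e"
    by (simp add: fc_dist_eq_folded_weight[OF x y] folded_weight_inject_if_same_parity)
  then show ?thesis
    using card_d card_e by linarith
qed

lemma base_vertex_in_vertices: "base_vertex D \<in> vertices D"
  and small_base_vertex: "small (base_vertex D) = {}"
  using vertex_of_small_subset[of "{}" D] by (simp_all add: base_vertex_def)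

lemma fc_dist_base_vertex:
  assumes "x \<in> vertices D"
  shows "fc_dist (base_vertex D) x = card (small x)"
  using card_small_le[OF assms]
  by (simp add: fc_dist_eq_folded_weight[OF base_vertex_in_vertices assms] small_base_vertex
      folded_weight_def)

lemma dual_idem_apply:
  "dual_idem D k x y = (if x \<in> vertices D \<and> y = x \<and> card (small x) = k then 1 else 0)"
  by (auto simp: dual_idem_def fc_dist_base_vertex)

section \<open>Orbits of pairs of vertices\<close>

definition relabel :: "(nat \<Rightarrow> nat) \<Rightarrow> vertex \<Rightarrow> vertex" where
  "relabel \<pi> = (`) ((`) \<pi>)"

definition relabelings :: "nat \<Rightarrow> (vertex \<Rightarrow> vertex) set" where
  "relabelings D = relabel ` {\<pi>. \<pi> permutes ground D}"

lemma
  assumes \<pi>: "\<pi> permutes ground D" and x: "x \<in> vertices D"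
  shows relabel_in_vertices: "relabel \<pi> x \<in> vertices D"
    and small_relabel: "small (relabel \<pi> x) = \<pi> ` small x"
    and large_relabel: "large (relabel \<pi> x) = \<pi> ` large x"
proof -
  have compl: "\<pi> ` large x = ground D - \<pi> ` small x"
    using permutes_inj[OF \<pi>] permutes_image[OF \<pi>]
    by (simp add: large_eq_Diff_small[OF x] image_set_diff)
  have "\<pi> ` small x \<subseteq> ground D"
    using small_subset_ground[OF x] permutes_image[OF \<pi>] by blast
  moreover have "card (\<pi> ` small x) \<le> D"
    using card_small_le[OF x] permutes_inj_on[OF \<pi>] by (simp add: card_image)
  moreover have "relabel \<pi> x = {\<pi> ` small x, ground D - \<pi> ` small x}"
    using arg_cong[OF vertex_eq_small_large[OF x], of "relabel \<pi>"]
    by (simp add: relabel_def compl)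
  ultimately show "relabel \<pi> x \<in> vertices D" "small (relabel \<pi> x) = \<pi> ` small x"
    "large (relabel \<pi> x) = \<pi> ` large x"
    by (simp_all add: vertex_of_small_subset compl)
qed

lemma bij_betw_relabel:
  assumes "\<pi> permutes ground D"
  shows "bij_betw (relabel \<pi>) (vertices D) (vertices D)"
proof -
  have "bij_betw (relabel \<pi>) (Pow (Pow (ground D))) (Pow (Pow (ground D)))"
    unfolding relabel_def using assms by (intro bij_betw_image_Pow permutes_imp_bij)
  then have "inj_on (relabel \<pi>) (vertices D)"
    using bij_betw_imp_inj_on inj_on_subset vertices_subset_Pow_Pow by metis
  moreover have "relabel \<pi> ` vertices D \<subseteq> vertices D"
    using relabel_in_vertices[OF assms] by blast
  ultimately show ?thesis
    by (simp add: bij_betw_def endo_inj_surj)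
qed

lemma fc_dist_relabel:
  assumes "\<pi> permutes ground D" "x \<in> vertices D" "y \<in> vertices D"
  shows "fc_dist (relabel \<pi> x) (relabel \<pi> y) = fc_dist x y"
  using assms
  by (simp add: fc_dist_def small_relabel large_relabel card_sym_diff_image permutes_inj)

definition pair_type :: "vertex \<Rightarrow> vertex \<Rightarrow> nat \<times> nat \<times> nat" where
  "pair_type x y = (card (small x), card (small y), card (small x \<inter> small y))"

lemma pair_type_in_index_set:
  assumes x: "x \<in> vertices D" and y: "y \<in> vertices D"
  shows "pair_type x y \<in> index_set D"
  using finite_small[OF x] finite_small[OF y] card_small_le[OF x] card_small_le[OF y]
  by (simp add: index_set_def pair_type_def card_mono)

lemma ex_vertices_of_pair_type:
  assumes "p \<in> index_set D"
  shows "\<exists>x\<in>vertices D. \<exists>y\<in>vertices D. pair_type x y = p"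
proof -
  obtain i j t where p: "p = (i, j, t)"
    and le: "t \<le> i" "t \<le> j" "i \<le> D" "j \<le> D" "i + j - t \<le> 2 * D"
    using assms by (auto simp: index_set_def)
  define a where "a = {1..i}"
  define b where "b = {i - t + 1..i + j - t}"
  have "a \<inter> b = {i - t + 1..i}"
    using le by (auto simp: a_def b_def)
  then have card: "card a = i" "card b = j" "card (a \<inter> b) = t"
    using le by (simp_all add: a_def b_def)
  have a: "a \<subseteq> ground D" "card a \<le> D" and b: "b \<subseteq> ground D" "card b \<le> D"
    using le card by (auto simp: a_def b_def ground_def)
  show ?thesis
  proof (intro bexI)
    show "pair_type {a, ground D - a} {b, ground D - b} = p"
      using card
      by (simp add: pair_type_def vertex_of_small_subset[OF a] vertex_of_small_subset[OF b] p)
  qed (use a b vertex_of_small_subset(1) in blast)+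
qed

lemma pair_type_representatives:
  obtains r s where "\<And>p. p \<in> index_set D \<Longrightarrow>
    r p \<in> vertices D \<and> s p \<in> vertices D \<and> pair_type (r p) (s p) = p"
proof -
  have "\<forall>p\<in>index_set D. \<exists>x y. x \<in> vertices D \<and> y \<in> vertices D \<and> pair_type x y = p"
    using ex_vertices_of_pair_type by blast
  then show thesis
    unfolding bchoice_iff using that by blast
qed

lemma ex_relabeling_if_pair_type_eq:
  assumes v: "x \<in> vertices D" "y \<in> vertices D" "x' \<in> vertices D" "y' \<in> vertices D"
    and type: "pair_type x y = pair_type x' y'"
  obtains g where "g \<in> relabelings D" "g x = x'" "g y = y'"
proof -
  obtain \<pi> where \<pi>: "\<pi> permutes ground D" "\<pi> ` small x = small x'" "\<pi> ` small y = small y'"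
    using ex_permutes_image_two_subsets[OF finite_ground v[THEN small_subset_ground]] type
    by (auto simp: pair_type_def)
  show thesis
  proof
    show "relabel \<pi> \<in> relabelings D"
      using \<pi>(1) by (simp add: relabelings_def)
    show "relabel \<pi> x = x'" "relabel \<pi> y = y'"
      using v \<pi> small_relabel relabel_in_vertices small_inject by metis+
  qed
qed

section \<open>Invariant matrices\<close>

definition invariant_matrices :: "nat \<Rightarrow> (vertex \<Rightarrow> vertex) set \<Rightarrow> matrix set" where
  "invariant_matrices D G =
    {P \<in> matrices D. \<forall>g\<in>G. \<forall>x\<in>vertices D. \<forall>y\<in>vertices D. P (g x) (g y) = P x y}"

lemma mat_mult_invariant:
  assumes "bij_betw g (vertices D) (vertices D)"
    and P: "\<And>z. z \<in> vertices D \<Longrightarrow> P (g x) (g z) = P x z"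
    and Q: "\<And>z. z \<in> vertices D \<Longrightarrow> Q (g z) (g y) = Q z y"
  shows "mat_mult D P Q (g x) (g y) = mat_mult D P Q x y"
proof -
  have "mat_mult D P Q (g x) (g y) = (\<Sum>z\<in>vertices D. P (g x) (g z) * Q (g z) (g y))"
    unfolding mat_mult_def by (rule sum.reindex_bij_betw[OF assms(1), symmetric])
  also have "\<dots> = mat_mult D P Q x y"
    unfolding mat_mult_def by (intro sum.cong) (simp_all add: P Q)
  finally show ?thesis .
qed

lemma subalgebra_invariant_matrices:
  assumes bij: "\<And>g. g \<in> G \<Longrightarrow> bij_betw g (vertices D) (vertices D)"
  shows "subalgebra D (invariant_matrices D G)"
proof -
  have sub: "mat_vs.subspace (matrices D)" and one: "mat_one D \<in> matrices D"
    and mult: "\<And>P Q. P \<in> matrices D \<Longrightarrow> Q \<in> matrices D \<Longrightarrow> mat_mult D P Q \<in> matrices D"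
    using subalgebra_matrices[of D] by (auto simp: subalgebra_def)
  have "mat_vs.subspace (invariant_matrices D G)"
    using sub by (simp add: mat_vs.subspace_def invariant_matrices_def mat_scale_def)
  moreover have "g x \<in> vertices D \<and> (g y = g x \<longleftrightarrow> y = x)"
    if "g \<in> G" "x \<in> vertices D" "y \<in> vertices D" for g x y
    using bij[OF that(1)] that(2,3) by (auto simp: bij_betw_def inj_on_eq_iff)
  then have "mat_one D \<in> invariant_matrices D G"
    using one by (simp add: invariant_matrices_def mat_one_def)
  moreover have "mat_mult D P Q \<in> invariant_matrices D G"
    if "P \<in> invariant_matrices D G" "Q \<in> invariant_matrices D G" for P Q
    using that mult bij by (simp add: invariant_matrices_def mat_mult_invariant)
  ultimately show ?thesis
    by (auto simp: subalgebra_def invariant_matrices_def)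
qed

lemma subalgebra_relabeling_invariant:
  "subalgebra D (invariant_matrices D (relabelings D))"
  by (rule subalgebra_invariant_matrices) (auto simp: relabelings_def bij_betw_relabel)

lemma dist_mat_relabeling_invariant:
  "dist_mat D k \<in> invariant_matrices D (relabelings D)"
  by (auto simp: invariant_matrices_def matrices_def relabelings_def dist_mat_def
      relabel_in_vertices fc_dist_relabel)

lemma dual_idem_relabeling_invariant:
  "dual_idem D k \<in> invariant_matrices D (relabelings D)"
proof -
  have "relabel \<pi> y = relabel \<pi> x \<longleftrightarrow> y = x"
    if "\<pi> permutes ground D" "x \<in> vertices D" "y \<in> vertices D" for \<pi> x y
    using bij_betw_imp_inj_on[OF bij_betw_relabel[OF that(1)]] that(2,3)
    by (simp add: inj_on_eq_iff)
  moreover have "card (small (relabel \<pi> x)) = card (small x)"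
    if "\<pi> permutes ground D" "x \<in> vertices D" for \<pi> x
    using that by (simp add: small_relabel card_image permutes_inj_on)
  ultimately show ?thesis
    by (auto simp: invariant_matrices_def matrices_def relabelings_def dual_idem_apply
        relabel_in_vertices)
qed

lemma terwilliger_algebra_subset_invariant_matrices:
  "terwilliger_algebra D \<subseteq> invariant_matrices D (relabelings D)"
  unfolding terwilliger_algebra_def
  by (rule hull_minimal) (auto intro: dist_mat_relabeling_invariant dual_idem_relabeling_invariant
      subalgebra_relabeling_invariant)

section \<open>The matrices of the pair types\<close>

lemma M_mat_apply:
  "M_mat D p x y = (if x \<in> vertices D \<and> y \<in> vertices D \<and> pair_type x y = p then 1 else 0)"
  by (cases p) (simp add: M_mat_def pair_type_def)

lemma finite_index_set [simp]: "finite (index_set D)"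
  by (rule finite_subset[of _ "{..D} \<times> {..D} \<times> {..D}"]) (auto simp: index_set_def)

lemma basis_family_M_mat: "basis_family (M_mat D) (index_set D) (A_prime D)"
proof -
  obtain r s where rs: "\<And>p. p \<in> index_set D \<Longrightarrow>
    r p \<in> vertices D \<and> s p \<in> vertices D \<and> pair_type (r p) (s p) = p"
    using pair_type_representatives by blast
  have "Vector_Spaces.linear mat_scale (*) (\<lambda>P. P (r p) (s p))" for p
    by unfold_locales (simp_all add: mat_scale_def algebra_simps)
  moreover have "M_mat D q (r p) (s p) = (if p = q then 1 else 0)" if "p \<in> index_set D" for p q
    using rs[OF that] by (simp add: M_mat_apply)
  ultimately show ?thesis
    using mat_vs.independent_family_if_dual_functionals
      [where I = "index_set D" and F = "M_mat D" and \<phi> = "\<lambda>p P. P (r p) (s p)"]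
    by (simp add: basis_family_def A_prime_def)
qed

lemma sum_mat_scale_M_mat_apply:
  "(\<Sum>p\<in>index_set D. mat_scale (f p) (M_mat D p)) x y =
    (if x \<in> vertices D \<and> y \<in> vertices D then f (pair_type x y) else 0)"
proof -
  have "(\<Sum>p\<in>I. mat_scale (f p) (M_mat D p)) x y = (\<Sum>p\<in>I. f p * M_mat D p x y)" for I
    by (induction I rule: infinite_finite_induct) (simp_all add: mat_scale_def)
  then show ?thesis
    using pair_type_in_index_set
    by (cases "x \<in> vertices D \<and> y \<in> vertices D")
      (auto simp: M_mat_apply if_distrib cong: if_cong)
qed

lemma invariant_matrix_factors_through_pair_type:
  assumes P: "P \<in> invariant_matrices D (relabelings D)"
  obtains f where "\<And>x y. x \<in> vertices D \<Longrightarrow> y \<in> vertices D \<Longrightarrow> P x y = f (pair_type x y)"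
proof -
  obtain r s where rs: "\<And>p. p \<in> index_set D \<Longrightarrow>
    r p \<in> vertices D \<and> s p \<in> vertices D \<and> pair_type (r p) (s p) = p"
    using pair_type_representatives by blast
  have "P x y = P (r (pair_type x y)) (s (pair_type x y))"
    if xy: "x \<in> vertices D" "y \<in> vertices D" for x y
  proof -
    have "r (pair_type x y) \<in> vertices D" "s (pair_type x y) \<in> vertices D"
      "pair_type x y = pair_type (r (pair_type x y)) (s (pair_type x y))"
      using rs[OF pair_type_in_index_set[OF xy]] by simp_all
    then obtain g where "g \<in> relabelings D" "g x = r (pair_type x y)" "g y = s (pair_type x y)"
      by (rule ex_relabeling_if_pair_type_eq[OF xy])
    with P xy show ?thesis
      by (force simp: invariant_matrices_def)
  qed
  then show thesis
    by (rule that)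
qed

lemma invariant_matrices_subset_A_prime:
  "invariant_matrices D (relabelings D) \<subseteq> A_prime D"
proof
  fix P assume P: "P \<in> invariant_matrices D (relabelings D)"
  then obtain f where f: "\<And>x y. x \<in> vertices D \<Longrightarrow> y \<in> vertices D \<Longrightarrow> P x y = f (pair_type x y)"
    by (rule invariant_matrix_factors_through_pair_type) blast
  have "P x y = 0" if "\<not> (x \<in> vertices D \<and> y \<in> vertices D)" for x y
    using P that by (auto simp: invariant_matrices_def matrices_def)
  then have "P = (\<Sum>p\<in>index_set D. mat_scale (f p) (M_mat D p))"
    by (intro ext) (simp add: sum_mat_scale_M_mat_apply f)
  also have "\<dots> \<in> A_prime D"
    unfolding A_prime_def
    by (intro mat_vs.span_sum mat_vs.span_scale mat_vs.span_base imageI)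
  finally show "P \<in> A_prime D" .
qed

lemma mat_mult_dual_idem_left:
  "mat_mult D (dual_idem D i) P x y = (if x \<in> vertices D \<and> card (small x) = i then P x y else 0)"
proof -
  have "mat_mult D (dual_idem D i) P x y =
    (\<Sum>z\<in>vertices D. if x = z then if card (small x) = i then P x y else 0 else 0)"
    unfolding mat_mult_def by (intro sum.cong) (auto simp: dual_idem_apply)
  then show ?thesis
    by simp
qed

lemma mat_mult_dual_idem_right:
  "mat_mult D P (dual_idem D j) x y = (if y \<in> vertices D \<and> card (small y) = j then P x y else 0)"
proof -
  have "mat_mult D P (dual_idem D j) x y =
    (\<Sum>z\<in>vertices D. if y = z then if card (small y) = j then P x y else 0 else 0)"
    unfolding mat_mult_def by (intro sum.cong) (auto simp: dual_idem_apply)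
  then show ?thesis
    by simp
qed

lemma M_mat_eq_dual_idem_dist_mat_dual_idem:
  assumes "t \<le> i" "t \<le> j"
  shows "M_mat D (i, j, t) = mat_mult D
    (mat_mult D (dual_idem D i) (dist_mat D (folded_weight D (i + j - 2 * t)))) (dual_idem D j)"
  using assms fc_dist_eq_iff_card_Int_eq
  by (auto simp: fun_eq_iff M_mat_def dist_mat_def mat_mult_dual_idem_left
      mat_mult_dual_idem_right)

lemma A_prime_subset_terwilliger_algebra: "A_prime D \<subseteq> terwilliger_algebra D"
proof -
  have "M_mat D p \<in> B"
    if p: "p \<in> index_set D" and B: "subalgebra D B"
      and gen: "dist_mat D ` {0..D} \<union> dual_idem D ` {0..D} \<subseteq> B" for p B
  proof -
    obtain i j t where ijt: "p = (i, j, t)" "i \<le> D" "j \<le> D" "t \<le> i" "t \<le> j"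
      using p by (auto simp: index_set_def)
    have "dual_idem D i \<in> B" "dual_idem D j \<in> B"
      "dist_mat D (folded_weight D (i + j - 2 * t)) \<in> B"
      using gen ijt(2,3) folded_weight_le by auto
    then show ?thesis
      using B ijt by (simp add: M_mat_eq_dual_idem_dist_mat_dual_idem subalgebra_def)
  qed
  then show ?thesis
    unfolding terwilliger_algebra_def hull_def A_prime_def
    by (intro Inter_greatest mat_vs.span_minimal) (auto simp: subalgebra_def)
qed

theorem theorem3p13:
  fixes D :: nat
  assumes "D \<ge> 3"
  shows "terwilliger_algebra D = A_prime D \<and> basis_family (M_mat D) (index_set D) (A_prime D)"
proof
  show "terwilliger_algebra D = A_prime D"
    using A_prime_subset_terwilliger_algebra terwilliger_algebra_subset_invariant_matrices
      invariant_matrices_subset_A_prime by blast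
  show "basis_family (M_mat D) (index_set D) (A_prime D)"
    by (rule basis_family_M_mat)
qed

end
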